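(* Let $n\ge1$, let $S_1\subseteq\langle a^2\rangle\setminus\{1\}$ and $S_2\subseteq\langle a^2\rangle a\cup\langle a^2\rangle ab\cup\langle a^2\rangle ab^2$ be such that $S=S_1\cup S_2\subseteq U_{6n}$ satisfies $1\notin S=S^{-1}$. Then $\mathrm{Cay}(U_{6n},S)$ is integral if and only if all of the following hold for $0\le j\le 2n-1$ and $0\le k\le n-1$: (1) $S_1\in B(\langle a^2\rangle)$; (2) $\chi_j(S_2)$ is an integer; (3) $2\psi_k(S_2^2)$ is a perfect square (the square of an integer).
   Context: For an integer $n\ge1$, $U_{6n}=\langle a,b\mid a^{2n}=b^3=1,\ a^{-1}ba=b^{-1}\rangle$, a group of order $6n$ whose elements are uniquely $a^ib^\epsilon$ with $0\le i\le 2n-1$, $\epsilon\in\{0,1,2\}$. Let $\omega=\exp(\pi\imath/n)$. Its irreducible complex characters are: the $2n$ linear characters $\chi_j$ ($0\le j\le 2n-1$) given by $\chi_j(a^{2r}b^\epsilon)=\omega^{2jr}$ and $\chi_j(a^{2r+1}b^\epsilon)=\omega^{j(2r+1)}$ for all $\epsilon\in\{0,1,2\}$; and the $n$ degree-two characters $\psi_k$ ($0\le k\le n-1$) given by $\psi_k(a^{2r})=2\omega^{2kr}$, $\psi_k(a^{2r}b)=\psi_k(a^{2r}b^2)=-\omega^{2kr}$, $\psi_k(a^{2r+1}b^\epsilon)=0$. For a character $\chi$ and a subset $A$, $\chi(A)=\sum_{x\in A}\chi(x)$ (with $\chi(\emptyset)=0$) and $\chi(A^2)=\sum_{x_1,x_2\in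 A}\chi(x_1x_2)$ over all ordered pairs. For a finite group $G$, the Boolean algebra $B(G)$ is the collection of subsets of $G$ obtainable from the subgroups of $G$ by finitely many unions, intersections and complements (in $G$). For a group $G$ and $S\subseteq G$ with $1\notin S=S^{-1}$, the Cayley graph $\mathrm{Cay}(G,S)$ has vertex set $G$ and edges $\{g,sg\}$ for $g\in G,s\in S$. A graph is integral if all eigenvalues of its adjacency matrix are integers. *)

theory Defs
  imports Complex_Main "HOL-Algebra.Algebra"
begin

text \<open>The group U_{6n}: the element a^i b^e (0 <= i < 2n, 0 <= e < 3) is encoded as the pair (i, e).
  Since b a = a b^{-1}, we have (a^i b^e)(a^j b^f) = a^{i+j} b^{(-1)^j e + f}.\<close>

definition U6n :: "nat \<Rightarrow> (nat \<times> nat) monoid" where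
  "U6n n = \<lparr> carrier = {0..<2*n} \<times> {0..<3},
             monoid.mult = (\<lambda>(i, e) (j, f). ((i + j) mod (2*n),
                        (if even j then e + f else 2*e + f) mod 3)),
             monoid.one = (0, 0) \<rparr>"

definition gen_a :: "nat \<Rightarrow> nat \<times> nat" where "gen_a n = (1 mod (2*n), 0)"
definition gen_b :: "nat \<Rightarrow> nat \<times> nat" where "gen_b n = (0, 1)"

definition omega :: "nat \<Rightarrow> complex" where "omega n = exp (pi * \<i> / of_nat n)"

definition chi :: "nat \<Rightarrow> nat \<Rightarrow> nat \<times> nat \<Rightarrow> complex" where
  "chi n j x = (case x of (i, e) \<Rightarrow> omega n ^ (j * i))"

definition psi :: "nat \<Rightarrow> nat \<Rightarrow> nat \<times> nat \<Rightarrow> complex" where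
  "psi n k x = (case x of (i, e) \<Rightarrow>
      if odd i then 0 else if e = 0 then 2 * omega n ^ (k * i) else - (omega n ^ (k * i)))"

definition char_set :: "(nat \<times> nat \<Rightarrow> complex) \<Rightarrow> (nat \<times> nat) set \<Rightarrow> complex" where
  "char_set ch A = (\<Sum>x\<in>A. ch x)"

definition char_set_sq :: "nat \<Rightarrow> (nat \<times> nat \<Rightarrow> complex) \<Rightarrow> (nat \<times> nat) set \<Rightarrow> complex" where
  "char_set_sq n ch A = (\<Sum>x1\<in>A. \<Sum>x2\<in>A. ch (x1 \<otimes>\<^bsub>U6n n\<^esub> x2))"

inductive_set bool_alg :: "('a, 'b) monoid_scheme \<Rightarrow> 'a set set" for G where
  sub: "subgroup H G \<Longrightarrow> H \<in> bool_alg G"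
| un: "A \<in> bool_alg G \<Longrightarrow> B \<in> bool_alg G \<Longrightarrow> A \<union> B \<in> bool_alg G"
| int: "A \<in> bool_alg G \<Longrightarrow> B \<in> bool_alg G \<Longrightarrow> A \<inter> B \<in> bool_alg G"
| compl: "A \<in> bool_alg G \<Longrightarrow> carrier G - A \<in> bool_alg G"

definition cayley_adj :: "('a, 'b) monoid_scheme \<Rightarrow> 'a set \<Rightarrow> 'a \<Rightarrow> 'a \<Rightarrow> bool" where
  "cayley_adj G S g h = (\<exists>s\<in>S. h = s \<otimes>\<^bsub>G\<^esub> g \<or> g = s \<otimes>\<^bsub>G\<^esub> h)"

definition integral_graph :: "'a set \<Rightarrow> ('a \<Rightarrow> 'a \<Rightarrow> bool) \<Rightarrow> bool" where
  "integral_graph V adj = (\<forall>\<mu>::complex.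
     (\<exists>v. (\<exists>x\<in>V. v x \<noteq> 0) \<and>
          (\<forall>x\<in>V. (\<Sum>y\<in>V. (if adj x y then 1 else 0) * v y) = \<mu> * v x))
     \<longrightarrow> \<mu> \<in> \<int>)"

end

theory Submission
  imports Defs "HOL-Number_Theory.Residues" "Jordan_Normal_Form.Char_Poly"
begin

text \<open>Let \<open>\<zeta>\<close> be a primitive cube root of unity. The functions \<open>a^i b^e \<mapsto> \<omega>^(k i) \<zeta>^(t e)\<close>,
  restricted to even or to odd \<open>i\<close>, split the adjacency operator into blocks \<open>[[P, Q], [R, P]]\<close>,
  where \<open>P\<close> is the sum of \<open>\<omega>^(k i)\<close> over \<open>S1\<close>, and \<open>Q\<close> and \<open>R\<close> are the sums of
  \<open>\<omega>^(k i) \<zeta>^(t e)\<close> and \<open>\<omega>^(k i) \<zeta>^(2 t e)\<close> over \<open>S2\<close>. The eigenvalues are therefore the solutions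
  \<open>\<mu>\<close> of \<open>(\<mu> - P)^2 = Q R\<close>. For \<open>t = 0\<close> these are \<open>P \<plusminus> \<chi>_k(S2)\<close>, and for \<open>t = 1\<close> we have
  \<open>2 \<psi>_k(S2^2) = 4 Q R\<close>. A rational number in \<open>\<int>[\<xi>]\<close>, with \<open>\<xi>\<close> a root of unity, is an integer, which
  takes care of the factors 2.

  It remains to see that all \<open>P = P(k)\<close> are integers iff \<open>S1\<close> lies in the Boolean algebra, that is, iff
  \<open>S1\<close> is closed under passing to another generator of the same cyclic subgroup. If it is, then \<open>P(k)\<close>
  is a sum of integers by induction over cyclic subgroups. Conversely, if all \<open>P(k)\<close> are integers, then
  \<open>P(p k) \<equiv> P(k)^p \<equiv> P(k)\<close> modulo every prime \<open>p\<close>, hence \<open>P(p k) = P(k)\<close> for large \<open>p\<close>. A change of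
  generator \<open>x \<mapsto> x^u\<close> can be realised with a \<open>u\<close> having only large prime factors, and Fourier inversion
  concludes. This replaces the irreducibility of the cyclotomic polynomials.\<close>

section \<open>Integer combinations of powers of a root of unity\<close>

text \<open>\<open>v\<close> is an eigenvector of the integer matrix \<open>A\<close> (nonzero by
  entry \<open>j0\<close>), so \<open>w\<close> is a root of a monic integer polynomial, its
  characteristic polynomial.\<close>

lemma algebraic_int_of_integer_matrix:
  fixes w :: complex and v :: "nat \<Rightarrow> complex" and A :: "nat \<Rightarrow> nat \<Rightarrow> int"
  assumes ev: "\<And>j. j < m \<Longrightarrow> w * v j = (\<Sum>i<m. of_int (A j i) * v i)"
    and j0: "j0 < m" "v j0 \<noteq> 0"
  shows "algebraic_int w"
proof -
  define M where "M = mat m m (\<lambda>(j, i). A j i)"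
  have M: "M \<in> carrier_mat m m" by (simp add: M_def)
  let ?M = "map_mat of_int M :: complex mat"
  have M': "?M \<in> carrier_mat m m" using M by simp
  have "eigenvector ?M (vec m v) w"
    unfolding eigenvector_def
  proof (intro conjI)
    show "vec m v \<in> carrier_vec (dim_row ?M)" using M by simp
    show "vec m v \<noteq> 0\<^sub>v (dim_row ?M)"
    proof
      assume "vec m v = 0\<^sub>v (dim_row ?M)"
      then have "vec m v $ j0 = 0\<^sub>v (dim_row ?M) $ j0" by simp
      then show False using j0 M by simp
    qed
    show "?M *\<^sub>v vec m v = w \<cdot>\<^sub>v vec m v"
    proof (rule eq_vecI)
      show "dim_vec (?M *\<^sub>v vec m v) = dim_vec (w \<cdot>\<^sub>v vec m v)" using M by simp
      fix j assume "j < dim_vec (w \<cdot>\<^sub>v vec m v)"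
      then have j: "j < m" by simp
      then show "(?M *\<^sub>v vec m v) $ j = (w \<cdot>\<^sub>v vec m v) $ j"
        using M by (simp add: ev M_def scalar_prod_def atLeast0LessThan)
    qed
  qed
  then have "Polynomial.poly (char_poly ?M) w = 0"
    using eigenvalue_root_char_poly[OF M'] unfolding eigenvalue_def by blast
  moreover have "char_poly ?M = map_poly of_int (char_poly M)"
    by (rule of_int_hom.char_poly_hom[OF M])
  moreover have "monic (char_poly M)"
    using degree_monic_char_poly[OF M] by simp
  ultimately show ?thesis
    unfolding algebraic_int_altdef_ipoly by auto
qed

text \<open>The ring Z[\<open>\<xi>\<close>].\<close>

inductive_set int_adjoin :: "complex \<Rightarrow> complex set" for \<xi> where
  gen: "\<xi> \<in> int_adjoin \<xi>"
| of_int: "of_int c \<in> int_adjoin \<xi>"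
| add: "x \<in> int_adjoin \<xi> \<Longrightarrow> y \<in> int_adjoin \<xi> \<Longrightarrow> x + y \<in> int_adjoin \<xi>"
| mult: "x \<in> int_adjoin \<xi> \<Longrightarrow> y \<in> int_adjoin \<xi> \<Longrightarrow> x * y \<in> int_adjoin \<xi>"

lemma int_adjoin_of_nat: "of_nat c \<in> int_adjoin \<xi>"
  using int_adjoin.of_int[of "int c"] by simp

lemma int_adjoin_power: "x \<in> int_adjoin \<xi> \<Longrightarrow> x ^ m \<in> int_adjoin \<xi>"
  by (induction m) (auto intro: int_adjoin.mult int_adjoin_of_nat[of 1, simplified])

lemma int_adjoin_sum: "(\<And>i. i \<in> I \<Longrightarrow> f i \<in> int_adjoin \<xi>) \<Longrightarrow> sum f I \<in> int_adjoin \<xi>"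
  by (induction I rule: infinite_finite_induct)
    (auto intro: int_adjoin.add int_adjoin_of_nat[of 0, simplified])

text \<open>The extra factor \<open>\<xi> ^ j\<close> makes the statement stable under products, and it turns
  multiplication by \<open>x\<close> into an integer matrix having \<open>x\<close> as an eigenvalue.\<close>

lemma int_adjoin_span:
  assumes \<xi>: "\<xi> ^ N = 1" and N: "N > 0" and x: "x \<in> int_adjoin \<xi>"
  shows "\<exists>c :: nat \<Rightarrow> int. x * \<xi> ^ j = (\<Sum>i<N. of_int (c i) * \<xi> ^ i)"
  using x
proof (induction arbitrary: j)
  case gen
  have "\<xi> ^ Suc j = \<xi> ^ (Suc j mod N + N * (Suc j div N))"
    by (simp only: mod_mult_div_eq)
  also have "\<dots> = \<xi> ^ (Suc j mod N)"
    by (simp only: power_add power_mult \<xi> power_one mult_1_right)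
  also have "\<dots> = (\<Sum>i<N. of_int (if i = Suc j mod N then 1 else 0) * \<xi> ^ i)"
    using N by (simp add: if_distrib[of of_int] if_distrib[of "\<lambda>x. x * _"] cong: if_cong)
  finally show ?case by (intro exI) simp
next
  case (of_int c)
  have "\<xi> ^ j = \<xi> ^ (j mod N + N * (j div N))"
    by (simp only: mod_mult_div_eq)
  also have "\<dots> = \<xi> ^ (j mod N)"
    by (simp only: power_add power_mult \<xi> power_one mult_1_right)
  also have "of_int c * \<dots> = (\<Sum>i<N. of_int (if i = j mod N then c else 0) * \<xi> ^ i)"
    using N by (simp add: if_distrib[of of_int] if_distrib[of "\<lambda>x. x * _"] cong: if_cong)
  finally show ?case by (intro exI)
next
  case (add x y)
  obtain c d :: "nat \<Rightarrow> int" where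
    "x * \<xi> ^ j = (\<Sum>i<N. of_int (c i) * \<xi> ^ i)" "y * \<xi> ^ j = (\<Sum>i<N. of_int (d i) * \<xi> ^ i)"
    using add.IH by metis
  then have "(x + y) * \<xi> ^ j = (\<Sum>i<N. of_int (c i + d i) * \<xi> ^ i)"
    by (simp add: ring_distribs sum.distrib)
  then show ?case by (intro exI)
next
  case (mult x y)
  obtain d :: "nat \<Rightarrow> int" where d: "y * \<xi> ^ j = (\<Sum>i<N. of_int (d i) * \<xi> ^ i)"
    using mult.IH(2) by metis
  obtain c :: "nat \<Rightarrow> nat \<Rightarrow> int" where c: "\<And>i. x * \<xi> ^ i = (\<Sum>k<N. of_int (c i k) * \<xi> ^ k)"
    using mult.IH(1) by metis
  have "x * y * \<xi> ^ j = x * (y * \<xi> ^ j)" by (simp add: mult.assoc)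
  also have "\<dots> = (\<Sum>i<N. of_int (d i) * (x * \<xi> ^ i))"
    unfolding d by (simp add: sum_distrib_left mult_ac)
  also have "\<dots> = (\<Sum>i<N. \<Sum>k<N. of_int (d i * c i k) * \<xi> ^ k)"
    unfolding c by (simp add: sum_distrib_left mult_ac)
  also have "\<dots> = (\<Sum>k<N. of_int (\<Sum>i<N. d i * c i k) * \<xi> ^ k)"
    by (subst sum.swap) (simp add: sum_distrib_right)
  finally show ?case by (intro exI)
qed

text \<open>The vector of powers of \<open>\<xi>\<close>, whose entry 0 is 1, is an eigenvector for
  \<open>x\<close>; so \<open>x\<close> is an algebraic integer, and a rational one is an
  integer.\<close>

lemma int_adjoin_Rats_imp_Ints:
  assumes "\<xi> ^ N = 1" "N > 0" "x \<in> int_adjoin \<xi>" "x \<in> \<rat>"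
  shows "x \<in> \<int>"
proof -
  obtain A :: "nat \<Rightarrow> nat \<Rightarrow> int" where "\<And>j. x * \<xi> ^ j = (\<Sum>i<N. of_int (A j i) * \<xi> ^ i)"
    using int_adjoin_span[OF assms(1-3)] by metis
  then have "algebraic_int x"
    using assms(2) by (intro algebraic_int_of_integer_matrix[of N x "\<lambda>i. \<xi> ^ i" A 0]) auto
  then show ?thesis
    using assms(4) rational_algebraic_int_is_int by blast
qed

section \<open>Frobenius congruences for sums of roots of unity\<close>

text \<open>The inner binomial coefficients are divisible by \<open>p\<close>. The cofactor
  \<open>w\<close> is kept inside the ring so that integrality can be applied to it later.\<close>

lemma binomial_prime_power:
  assumes p: "Factorial_Ring.prime p" and x: "x \<in> int_adjoin \<xi>" and y: "y \<in> int_adjoin \<xi>"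
  shows "\<exists>w \<in> int_adjoin \<xi>. (x + y) ^ p = x ^ p + y ^ p + of_nat p * w"
proof -
  have p0: "p > 0" using p by (rule prime_gt_0_nat)
  define w where "w = (\<Sum>k\<in>{1..<p}. of_nat ((p choose k) div p) * x ^ k * y ^ (p - k))"
  have *: "of_nat (p choose k) * x ^ k * y ^ (p - k) =
      of_nat p * (of_nat ((p choose k) div p) * x ^ k * y ^ (p - k))" if "k \<in> {1..<p}" for k
  proof -
    have "p dvd (p choose k)"
      using p that by (intro dvd_choose_prime) auto
    then have "p choose k = p * ((p choose k) div p)" by simp
    then have "(of_nat (p choose k) :: complex) = of_nat p * of_nat ((p choose k) div p)"
      by (metis of_nat_mult)
    then show ?thesis by simp
  qed
  have "{..p} = insert 0 (insert p {1..<p})" using p0 by auto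
  then have "(x + y) ^ p = x ^ p + y ^ p + (\<Sum>k\<in>{1..<p}. of_nat (p choose k) * x ^ k * y ^ (p - k))"
    using p0 by (simp add: binomial_ring add_ac)
  also have "\<dots> = x ^ p + y ^ p + of_nat p * w"
    unfolding w_def sum_distrib_left by (subst sum.cong[OF refl *]) auto
  finally show ?thesis
    using x y unfolding w_def
    by (intro bexI[of _ w]) (auto simp: w_def intro!: int_adjoin_sum int_adjoin.mult int_adjoin_of_nat int_adjoin_power)
qed

lemma sum_prime_power:
  assumes p: "Factorial_Ring.prime p" and I: "finite I" and f: "\<And>i. i \<in> I \<Longrightarrow> f i \<in> int_adjoin \<xi>"
  shows "\<exists>w \<in> int_adjoin \<xi>. sum f I ^ p = (\<Sum>i\<in>I. f i ^ p) + of_nat p * w"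
  using I f
proof (induction I)
  case empty
  then show ?case
    using prime_gt_0_nat[OF p] by (auto intro!: bexI[of _ 0] int_adjoin_of_nat[of 0, simplified])
next
  case (insert i I)
  then obtain w where w: "w \<in> int_adjoin \<xi>" "sum f I ^ p = (\<Sum>i\<in>I. f i ^ p) + of_nat p * w"
    by auto
  obtain w' where w': "w' \<in> int_adjoin \<xi>" "(f i + sum f I) ^ p = f i ^ p + sum f I ^ p + of_nat p * w'"
    using binomial_prime_power[OF p, of "f i" \<xi> "sum f I"] insert by (auto intro: int_adjoin_sum)
  show ?case
    using insert.hyps w w'
    by (intro bexI[of _ "w + w'"]) (auto simp: algebra_simps intro: int_adjoin.add)
qed

text \<open>Modulo \<open>p\<close> we have \<open>P (p * k) = P k ^ p = P k\<close>, and both sides are too small to differ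
  by a nonzero multiple of \<open>p\<close>.\<close>

lemma sum_roots_of_unity_prime_multiple:
  fixes \<xi> :: complex and c :: "'a \<Rightarrow> nat" and I :: "'a set"
  defines "P \<equiv> \<lambda>k. \<Sum>s\<in>I. \<xi> ^ (k * c s)"
  assumes \<xi>: "\<xi> ^ N = 1" "N > 0" and I: "finite I" and P: "\<And>k. P k \<in> \<int>"
    and p: "Factorial_Ring.prime p" "p > 2 * card I"
  shows "P (p * k) = P k"
proof -
  have "norm \<xi> = 1"
    using power_eq_1_iff[OF \<xi>(1)] \<xi>(2) by simp
  then have bound: "norm (P k) \<le> card I" for k
    unfolding P_def by (intro order.trans[OF norm_sum]) (simp add: norm_power)
  have "\<exists>w\<in>int_adjoin \<xi>. P k ^ p = (\<Sum>s\<in>I. (\<xi> ^ (k * c s)) ^ p) + of_nat p * w"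
    unfolding P_def by (intro sum_prime_power p I int_adjoin_power int_adjoin.gen)
  then obtain w where w: "w \<in> int_adjoin \<xi>" "P k ^ p = (\<Sum>s\<in>I. (\<xi> ^ (k * c s)) ^ p) + of_nat p * w"
    by blast
  have "(\<Sum>s\<in>I. (\<xi> ^ (k * c s)) ^ p) = P (p * k)"
    unfolding P_def by (simp add: power_mult[symmetric] mult_ac)
  with w have eq: "P k ^ p = P (p * k) + of_nat p * w" by simp
  obtain a b where ab: "P k = of_int a" "P (p * k) = of_int b"
    using P[of k] P[of "p * k"] by (auto elim!: Ints_cases)
  have p0: "p > 0" using p(1) by (rule prime_gt_0_nat)
  \<comment> \<open>\<open>p * w\<close> is a difference of integers, so \<open>w\<close> is
    rational and hence an integer: the congruence in the ring becomes one between ordinary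
    integers.\<close>
  have weq: "w = of_int (a ^ p - b) / of_int (int p)"
    using eq p0 unfolding ab by (simp add: field_simps)
  then have "w \<in> \<rat>" by simp
  then have "w \<in> \<int>" using int_adjoin_Rats_imp_Ints[OF \<xi> w(1)] by blast
  then obtain z where "w = of_int z" by (auto elim: Ints_cases)
  then have "(of_int (a ^ p - b) :: complex) = of_int (int p * z)"
    using weq p0 by (simp add: field_simps)
  then have "a ^ p - b = int p * z" by (simp only: of_int_eq_iff)
  then have "int p dvd a ^ p - b" by simp
  \<comment> \<open>Fermat's little theorem, transferred to a possibly negative \<open>a\<close>
    through its residue.\<close>
  moreover have "int p dvd a ^ p - a"
  proof (cases "int p dvd a")
    case True
    then show ?thesis using p0 by (intro dvd_diff dvd_power_le[of "int p" a 1 p, simplified]) auto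
  next
    case False
    have "\<not> p dvd nat (a mod int p)"
      using False p0 by (subst int_dvd_int_iff[symmetric]) (simp add: dvd_mod_iff)
    then have "[nat (a mod int p) ^ (p - 1) = 1] (mod p)"
      using p(1) by (rule fermat_theorem[rotated])
    then have "[int (nat (a mod int p) ^ (p - 1)) = int 1] (mod int p)"
      by (simp only: cong_int_iff)
    then have "[(a mod int p) ^ (p - 1) = 1] (mod int p)"
      using p0 by simp
    then have "[a ^ (p - 1) = 1] (mod int p)"
      by (simp add: cong_def power_mod)
    then have "[a ^ (p - 1) * a = 1 * a] (mod int p)" by (rule cong_scalar_right)
    then show ?thesis
      using p0 by (simp add: cong_iff_dvd_diff power_Suc2[symmetric] del: power_Suc)
  qed
  ultimately have "int p dvd (a ^ p - b) - (a ^ p - a)" by (rule dvd_diff)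
  then have dvd: "int p dvd a - b" by simp
  have "norm (P k - P (p * k)) \<le> 2 * card I"
    using norm_triangle_ineq4[of "P k" "P (p * k)"] bound[of k] bound[of "p * k"] by linarith
  moreover have "P k - P (p * k) = of_int (a - b)" using ab by simp
  ultimately have "real_of_int \<bar>a - b\<bar> \<le> real_of_int (2 * int (card I))"
    by (simp only: norm_of_int of_int_mult of_int_numeral of_int_of_nat_eq of_nat_mult of_nat_numeral)
  then have "\<bar>a - b\<bar> \<le> 2 * int (card I)" by (simp only: of_int_le_iff)
  then have "\<bar>a - b\<bar> < int p" using p(2) by linarith
  then have "a - b = 0" using dvd dvd_imp_le_int[of "a - b" "int p"] by fastforce
  then show ?thesis using ab by simp
qed

text \<open>With \<open>t\<close> the product of the primes of \<open>M\<close> that do not divide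
  \<open>u\<close>, each prime of \<open>M\<close> divides exactly one of \<open>u\<close> and
  \<open>m * t\<close>, hence not their sum.\<close>

lemma exists_cong_coprime:
  fixes u m M :: nat
  assumes "coprime u m" "M > 0"
  shows "\<exists>u'. u' mod m = u mod m \<and> coprime u' M"
proof -
  define t where "t = \<Prod>{p. Factorial_Ring.prime p \<and> p dvd M \<and> \<not> p dvd u}"
  have fin: "finite {p. Factorial_Ring.prime p \<and> p dvd M \<and> \<not> p dvd u}"
    by (rule finite_subset[OF _ finite_divisors_nat[OF assms(2)]]) auto
  have "\<not> p dvd u + m * t" if p: "Factorial_Ring.prime p" "p dvd M" for p
  proof (cases "p dvd u")
    case True
    have "\<not> p dvd m"
      using True assms(1) p(1) by (meson coprime_common_divisor not_prime_unit)
    moreover have "\<not> p dvd t"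
    proof
      assume "p dvd t"
      then obtain q where q: "Factorial_Ring.prime q" "\<not> q dvd u" "p dvd q"
        unfolding t_def prime_dvd_prod_iff[OF fin p(1)] by auto
      then have "p = q" using p(1) by (simp add: primes_dvd_imp_eq)
      then show False using q True by simp
    qed
    ultimately show ?thesis
      using True p(1) by (simp add: dvd_add_right_iff prime_dvd_mult_iff)
  next
    case False
    then have "p dvd t" unfolding t_def using fin p by (intro dvd_prodI) auto
    then show ?thesis using False by (simp add: dvd_add_left_iff)
  qed
  moreover have "\<exists>p. Factorial_Ring.prime p \<and> p dvd gcd (u + m * t) M" if "gcd (u + m * t) M \<noteq> 1"
    using prime_factor_nat[OF that] by blast
  ultimately have "coprime (u + m * t) M"
    unfolding coprime_iff_gcd_eq_1 by (meson gcd_dvd1 gcd_dvd2 dvd_trans)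
  then show ?thesis by (intro exI[of _ "u + m * t"]) simp
qed

text \<open>Induction over the prime factors of \<open>u\<close>: coprimality to the factorial
  forces each of them above \<open>2 * card I\<close>, where the prime case applies.\<close>

lemma sum_roots_of_unity_coprime_multiple:
  fixes \<xi> :: complex and c :: "'a \<Rightarrow> nat" and I :: "'a set"
  defines "P \<equiv> \<lambda>k. \<Sum>s\<in>I. \<xi> ^ (k * c s)"
  assumes \<xi>: "\<xi> ^ N = 1" "N > 0" and I: "finite I" and P: "\<And>k. P k \<in> \<int>"
    and u: "coprime u (fact (2 * card I))" "u > 0"
  shows "P (u * k) = P k"
  using u
proof (induction u rule: prime_divisors_induct)
  case (factor p u)
  have "p > 2 * card I"
  proof (rule ccontr)
    assume "\<not> p > 2 * card I"
    then have "p dvd fact (2 * card I)"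
      using factor.hyps prime_gt_0_nat by (intro dvd_fact) (auto simp: Suc_leI)
    then show False
      using factor.prems factor.hyps by (metis coprime_common_divisor dvd_triv_left not_prime_unit)
  qed
  then have "P (p * (u * k)) = P (u * k)"
    using sum_roots_of_unity_prime_multiple[OF \<xi> I, of c p "u * k"] P factor.hyps unfolding P_def by blast
  moreover have "P (u * k) = P k"
    using factor.prems by (intro factor.IH) auto
  ultimately show ?case by (simp add: mult.assoc)
next
  case (unit u)
  then have "u = 1" by simp
  then show ?case by simp
next
  case zero
  from zero.prems(2) show ?case by simp
qed

text \<open>Orthogonality: weighting equation \<open>k\<close> by
  \<open>\<xi> ^ (k * (N - j))\<close>, the inverse of \<open>\<xi> ^ (k * j)\<close>, and summing
  over \<open>k\<close> isolates \<open>N * f j\<close>.\<close>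

lemma fourier_zero:
  fixes \<xi> :: complex
  assumes \<xi>: "\<xi> ^ N = 1" and prim: "\<And>j. 0 < j \<Longrightarrow> j < N \<Longrightarrow> \<xi> ^ j \<noteq> 1"
    and f: "\<And>k. k < N \<Longrightarrow> (\<Sum>i<N. f i * \<xi> ^ (k * i)) = 0" and j: "j < N"
  shows "f j = 0"
proof -
  have geom: "(\<Sum>k<N. \<xi> ^ (k * i) * \<xi> ^ (k * (N - j))) = (if i = j then of_nat N else 0)" if i: "i < N" for i
  proof -
    let ?z = "\<xi> ^ (i + (N - j))"
    have zN: "?z ^ N = 1" by (simp add: power_mult[symmetric] mult.commute[of _ N]) (simp add: power_mult \<xi>)
    have "(\<Sum>k<N. \<xi> ^ (k * i) * \<xi> ^ (k * (N - j))) = (\<Sum>k<N. ?z ^ k)"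
      by (simp add: power_mult[symmetric] power_add[symmetric] algebra_simps)
    moreover have "(\<Sum>k<N. ?z ^ k) = of_nat N" if "i = j"
    proof -
      have "?z = 1" using that j \<xi> by simp
      then show ?thesis by simp
    qed
    moreover have "(\<Sum>k<N. ?z ^ k) = 0" if ne: "i \<noteq> j"
    proof -
      have "?z \<noteq> 1"
      proof (cases "i < j")
        case True
        then show ?thesis using prim[of "i + (N - j)"] j by auto
      next
        case False
        then have "i + (N - j) = N + (i - j)" using j by auto
        then have "?z = \<xi> ^ (i - j)" by (simp add: power_add \<xi>)
        then show ?thesis using prim[of "i - j"] False ne i by auto
      qed
      then show ?thesis using zN by (simp add: geometric_sum)
    qed
    ultimately show ?thesis by auto
  qed
  have "0 = (\<Sum>k<N. (\<Sum>i<N. f i * \<xi> ^ (k * i)) * \<xi> ^ (k * (N - j)))"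
    using f by simp
  also have "\<dots> = (\<Sum>i<N. f i * (\<Sum>k<N. \<xi> ^ (k * i) * \<xi> ^ (k * (N - j))))"
    unfolding sum_distrib_right sum_distrib_left by (subst sum.swap) (simp add: mult.assoc)
  also have "\<dots> = (\<Sum>i<N. f i * (if i = j then of_nat N else 0))"
    using geom by (intro sum.cong) auto
  also have "\<dots> = f j * of_nat N"
    using j by (simp add: if_distrib[of "\<lambda>x. _ * x"] cong: if_cong)
  finally show ?thesis using j by simp
qed

section \<open>The Boolean algebra of a finite group\<close>

lemma bool_alg_Union:
  assumes "group G" "finite F" "F \<subseteq> bool_alg G"
  shows "\<Union>F \<in> bool_alg G"
  using assms(2,3)
proof (induction F)
  case empty
  \<comment> \<open>The empty union is the complement of the whole group.\<close>
  have "carrier G \<in> bool_alg G"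
    using assms(1) by (intro bool_alg.sub group.subgroup_self)
  from bool_alg.compl[OF this] show ?case by simp
qed (auto intro: bool_alg.un)

lemma bool_alg_Diff:
  assumes "A \<in> bool_alg G" "A \<subseteq> carrier G" "B \<in> bool_alg G"
  shows "A - B \<in> bool_alg G"
proof -
  have "A - B = A \<inter> (carrier G - B)" using assms(2) by blast
  then show ?thesis using assms by (simp add: bool_alg.int bool_alg.compl)
qed

context group
begin

lemma generate_singleton_subset_iff:
  "x \<in> carrier G \<Longrightarrow> y \<in> carrier G \<Longrightarrow>
    generate G {x} \<subseteq> generate G {y} \<longleftrightarrow> x \<in> generate G {y}"
  using generate_subgroup_incl[of "{x}" "generate G {y}"] generate_is_subgroup[of "{y}"]
  by (auto intro: generate.incl)

text \<open>A subgroup contains \<open>x\<close> iff it contains \<open>generate G {x}\<close>; the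
  closure condition is symmetric in the two elements, so it also survives complements.\<close>

lemma bool_alg_imp_closed:
  assumes "Y \<in> bool_alg G"
  shows "Y \<subseteq> carrier G \<and>
    (\<forall>x\<in>Y. \<forall>y\<in>carrier G. generate G {x} = generate G {y} \<longrightarrow> y \<in> Y)"
  using assms
proof (induction rule: bool_alg.induct)
  case (sub H)
  then have H: "subgroup H G" by simp
  have "y \<in> H" if "x \<in> H" "generate G {x} = generate G {y}" for x y
    using generate_subgroup_incl[of "{x}" H] H that generate.incl[of y "{y}" G] by auto
  then show ?case using subgroup.subset[OF H] by blast
next
  case (compl A)
  then show ?case by (metis DiffE DiffI Diff_subset)
qed blast+

text \<open>The generators of a cyclic subgroup are what remains after removing its proper cyclic
  subgroups, so each class \<open>C x\<close> lies in the algebra; a closed \<open>Y\<close> is a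
  finite union of such classes.\<close>

lemma bool_alg_iff:
  assumes fin: "finite (carrier G)"
  shows "Y \<in> bool_alg G \<longleftrightarrow> Y \<subseteq> carrier G \<and>
    (\<forall>x\<in>Y. \<forall>y\<in>carrier G. generate G {x} = generate G {y} \<longrightarrow> y \<in> Y)"
proof (intro iffI bool_alg_imp_closed)
  assume closed: "Y \<subseteq> carrier G \<and>
    (\<forall>x\<in>Y. \<forall>y\<in>carrier G. generate G {x} = generate G {y} \<longrightarrow> y \<in> Y)"
  define C where "C x = {y \<in> carrier G. generate G {x} = generate G {y}}" for x
  have gen: "generate G {x} \<in> bool_alg G" if "x \<in> carrier G" for x
    using that by (intro bool_alg.sub generate_is_subgroup) auto
  have sub: "generate G {x} \<subseteq> carrier G" if "x \<in> carrier G" for x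
    using that generate_incl[of "{x}"] by auto
  have C: "C x \<in> bool_alg G" if x: "x \<in> carrier G" for x
  proof -
    define D where "D = (\<lambda>z. generate G {z}) ` {z \<in> generate G {x}. generate G {z} \<noteq> generate G {x}}"
    have "finite (generate G {x})" using fin sub[OF x] by (rule finite_subset[rotated])
    then have "finite D" unfolding D_def by simp
    moreover have "D \<subseteq> bool_alg G" unfolding D_def using sub[OF x] gen by blast
    ultimately have "\<Union>D \<in> bool_alg G" by (intro bool_alg_Union is_group)
    then have "generate G {x} - \<Union>D \<in> bool_alg G"
      using gen[OF x] sub[OF x] by (intro bool_alg_Diff)
    moreover have "C x = generate G {x} - \<Union>D"
    proof (intro equalityI subsetI)
      fix y assume "y \<in> C x"
      then have y: "y \<in> carrier G" "generate G {x} = generate G {y}" by (auto simp: C_def)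
      have "y \<in> generate G {x}" using y(2) generate.incl[of y "{y}" G] by simp
      moreover have "y \<notin> \<Union>D"
      proof
        assume "y \<in> \<Union>D"
        then obtain z where z: "z \<in> generate G {x}" "generate G {z} \<noteq> generate G {x}" "y \<in> generate G {z}"
          unfolding D_def by blast
        have "z \<in> carrier G" using z(1) sub[OF x] by blast
        then have "generate G {z} = generate G {x}"
          using z(1,3) x y by (metis generate_singleton_subset_iff subset_antisym)
        then show False using z(2) by simp
      qed
      ultimately show "y \<in> generate G {x} - \<Union>D" by blast
    next
      fix y assume y: "y \<in> generate G {x} - \<Union>D"
      then have "generate G {y} = generate G {x}"
        unfolding D_def using generate.incl[of y "{y}" G] by auto
      then show "y \<in> C x" using y sub[OF x] unfolding C_def by auto
    qed
    ultimately show ?thesis by simp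
  qed
  have "Y = \<Union>(C ` Y)" using closed unfolding C_def by blast
  moreover have "\<Union>(C ` Y) \<in> bool_alg G"
    using closed C finite_subset[OF _ fin] by (intro bool_alg_Union is_group) auto
  ultimately show "Y \<in> bool_alg G" by simp
qed

text \<open>If \<open>f\<close> is 1 on \<open>K\<close>, the sum is the order of \<open>K\<close>.
  Otherwise translation by some \<open>y\<close> with \<open>f y \<noteq> 1\<close> both preserves
  the sum and multiplies it by \<open>f y\<close>, so it is 0.\<close>

lemma sum_hom_subgroup_Ints:
  fixes f :: "'a \<Rightarrow> complex"
  assumes hom: "\<And>x y. x \<in> carrier G \<Longrightarrow> y \<in> carrier G \<Longrightarrow> f (x \<otimes> y) = f x * f y"
    and K: "subgroup K G"
  shows "sum f K \<in> \<int>"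
proof (cases "\<forall>y\<in>K. f y = 1")
  case True
  then have "sum f K = of_nat (card K)" by simp
  then show ?thesis by simp
next
  case False
  then obtain y where y: "y \<in> K" "f y \<noteq> 1" by blast
  note KG = subgroup.mem_carrier[OF K]
  have "bij_betw (\<lambda>x. y \<otimes> x) K K"
    using y subgroup.m_closed[OF K] subgroup.m_inv_closed[OF K] KG
    by (intro bij_betwI[where g = "\<lambda>x. inv y \<otimes> x"]) (auto simp: m_assoc[symmetric])
  then have "sum f K = (\<Sum>x\<in>K. f (y \<otimes> x))"
    by (simp add: sum.reindex_bij_betw)
  also have "\<dots> = f y * sum f K"
    using y KG hom by (simp add: sum_distrib_left)
  finally have "sum f K = 0" using y(2) by (simp add: mult_cancel_right1)
  then show ?thesis by simp
qed

text \<open>Strong induction on the order: the cyclic subgroup is partitioned by what its elements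
  generate, its total is an integer, and all classes but that of \<open>x\<close> belong to smaller
  cyclic subgroups.\<close>

lemma sum_hom_generators_Ints:
  fixes f :: "'a \<Rightarrow> complex"
  assumes fin: "finite (carrier G)"
    and hom: "\<And>x y. x \<in> carrier G \<Longrightarrow> y \<in> carrier G \<Longrightarrow> f (x \<otimes> y) = f x * f y"
    and x: "x \<in> carrier G"
  shows "sum f {y \<in> carrier G. generate G {y} = generate G {x}} \<in> \<int>"
  using x
proof (induction "card (generate G {x})" arbitrary: x rule: less_induct)
  case less
  let ?gen = "\<lambda>y. generate G {y}"
  let ?C = "\<lambda>x. {y \<in> carrier G. ?gen y = ?gen x}"
  have sub: "?gen x \<subseteq> carrier G"
    using less.prems generate_incl[of "{x}"] by auto
  then have finK: "finite (?gen x)" using fin finite_subset by blast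
  have Keq: "{y \<in> ?gen x. ?gen y = ?gen z} = ?C z" if "z \<in> ?gen x" for z
  proof -
    have "?gen z \<subseteq> ?gen x"
      using that sub less.prems by (subst generate_singleton_subset_iff) auto
    moreover have "y \<in> ?gen y" for y by (rule generate.incl) simp
    ultimately show ?thesis using sub by blast
  qed
  have xin: "x \<in> ?gen x" by (rule generate.incl) simp
  have "sum f (?gen x) = (\<Sum>L\<in>?gen ` ?gen x. sum f {y \<in> ?gen x. ?gen y = L})"
    by (rule sum.image_gen[OF finK])
  also have "\<dots> = sum f {y \<in> ?gen x. ?gen y = ?gen x}
      + (\<Sum>L\<in>?gen ` ?gen x - {?gen x}. sum f {y \<in> ?gen x. ?gen y = L})"
    using finK xin by (intro sum.remove) auto
  finally have eq: "sum f (?C x) = sum f (?gen x)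
      - (\<Sum>L\<in>?gen ` ?gen x - {?gen x}. sum f {y \<in> ?gen x. ?gen y = L})"
    using Keq[OF xin] by simp
  have "sum f {y \<in> ?gen x. ?gen y = L} \<in> \<int>" if L: "L \<in> ?gen ` ?gen x - {?gen x}" for L
  proof -
    obtain z where z: "z \<in> ?gen x" "L = ?gen z" "?gen z \<noteq> ?gen x" using L by blast
    then have "?gen z \<subset> ?gen x"
      using sub less.prems generate_singleton_subset_iff[of z x] by blast
    then have "card (?gen z) < card (?gen x)" using finK by (intro psubset_card_mono)
    then have "sum f (?C z) \<in> \<int>" using z sub by (intro less.hyps) auto
    then show ?thesis using Keq[OF z(1)] z(2) by simp
  qed
  moreover have "sum f (?gen x) \<in> \<int>"
    using less.prems by (intro sum_hom_subgroup_Ints[OF hom] generate_is_subgroup) auto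
  ultimately show ?case unfolding eq by (rule Ints_diff[OF _ Ints_sum, rotated])
qed

lemma sum_hom_bool_alg_Ints:
  fixes f :: "'a \<Rightarrow> complex"
  assumes fin: "finite (carrier G)"
    and hom: "\<And>x y. x \<in> carrier G \<Longrightarrow> y \<in> carrier G \<Longrightarrow> f (x \<otimes> y) = f x * f y"
    and Y: "Y \<in> bool_alg G"
  shows "sum f Y \<in> \<int>"
proof -
  have closed: "Y \<subseteq> carrier G"
    "\<And>x y. x \<in> Y \<Longrightarrow> y \<in> carrier G \<Longrightarrow> generate G {x} = generate G {y} \<Longrightarrow> y \<in> Y"
    using bool_alg_imp_closed[OF Y] by blast+
  then have finY: "finite Y" using fin finite_subset by blast
  have "sum f {y \<in> Y. generate G {y} = L} \<in> \<int>" if L: "L \<in> (\<lambda>y. generate G {y}) ` Y" for L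
  proof -
    obtain x where x: "x \<in> Y" "L = generate G {x}" using L by blast
    have "{y \<in> Y. generate G {y} = L} = {y \<in> carrier G. generate G {y} = generate G {x}}"
      using x closed by fastforce
    then show ?thesis using sum_hom_generators_Ints[OF fin hom, of x] x closed by auto
  qed
  then show ?thesis
    unfolding sum.image_gen[OF finY, of f "\<lambda>y. generate G {y}"] by (rule Ints_sum)
qed

end

section \<open>The group and its adjacency operators\<close>

lemma power_mult_mod:
  fixes \<xi> :: complex
  assumes "\<xi> ^ N = 1"
  shows "\<xi> ^ (k * (i mod N)) = \<xi> ^ (k * i)"
proof -
  have "\<xi> ^ (k * i) = \<xi> ^ (k * (i mod N) + N * (k * (i div N)))"
    by (metis mod_mult_div_eq add_mult_distrib2 mult.left_commute)
  then show ?thesis by (simp add: power_add power_mult assms)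
qed

lemma cis_primitive_root:
  assumes "N > 0"
  shows "cis (2 * pi / real N) ^ N = 1"
    and "\<And>j. 0 < j \<Longrightarrow> j < N \<Longrightarrow> cis (2 * pi / real N) ^ j \<noteq> 1"
proof -
  show "cis (2 * pi / real N) ^ N = 1"
    using assms by (simp add: DeMoivre)
  fix j assume j: "0 < j" "j < N"
  have "inj_on (\<lambda>k. cis (2 * pi * real k / real N)) {..<N}"
    using bij_betw_roots_unity[OF assms] by (rule bij_betw_imp_inj_on)
  then have "cis (2 * pi * real j / real N) \<noteq> cis (2 * pi * real 0 / real N)"
    using j by (metis inj_onD lessThan_iff assms less_irrefl)
  then show "cis (2 * pi / real N) ^ j \<noteq> 1"
    by (simp add: DeMoivre mult_ac)
qed

lemma omega_eq: "omega n = cis (2 * pi / real (2 * n))"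
  by (simp add: omega_def cis_conv_exp mult_ac)

definition zeta3 :: complex where "zeta3 = cis (2 * pi / real 3)"

lemma zeta3_power_3: "zeta3 ^ 3 = 1"
  unfolding zeta3_def by (rule cis_primitive_root) simp

lemma omega_power: "n \<ge> 1 \<Longrightarrow> omega n ^ (2 * n) = 1"
  unfolding omega_eq by (rule cis_primitive_root) simp

lemma U6n_carrier: "carrier (U6n n) = {0..<2*n} \<times> {0..<3}"
  and U6n_mult: "(i, e) \<otimes>\<^bsub>U6n n\<^esub> (j, f) =
    ((i + j) mod (2*n), (if even j then e + f else 2*e + f) mod 3)"
  and U6n_one: "\<one>\<^bsub>U6n n\<^esub> = (0, 0)"
  by (simp_all add: U6n_def)

lemma even_mod_double: "even (i mod (2 * n)) \<longleftrightarrow> even (i :: nat)"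
  by (simp add: dvd_mod_iff)

lemma group_U6n:
  assumes n: "n \<ge> 1"
  shows "group (U6n n)"
proof (rule groupI)
  fix x y assume "x \<in> carrier (U6n n)" "y \<in> carrier (U6n n)"
  then show "x \<otimes>\<^bsub>U6n n\<^esub> y \<in> carrier (U6n n)"
    using n by (cases x, cases y) (simp add: U6n_carrier U6n_mult)
next
  show "\<one>\<^bsub>U6n n\<^esub> \<in> carrier (U6n n)" using n by (simp add: U6n_carrier U6n_one)
next
  fix x y z :: "nat \<times> nat"
  obtain i e where x: "x = (i, e)" by (cases x)
  obtain j f where y: "y = (j, f)" by (cases y)
  obtain k g where z: "z = (k, g)" by (cases z)
  \<comment> \<open>Passing an odd power of \<open>a\<close> inverts the power of \<open>b\<close>,
    which is doubling modulo 3; two inversions cancel because 4 is 1 modulo 3.\<close>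
  have "(2 * ((2 * e + f) mod 3) + g) mod 3 = (2 * (2 * e + f) + g) mod 3"
    by (metis mod_add_left_eq mod_mult_right_eq)
  also have "2 * (2 * e + f) + g = (e + (2 * f + g)) + 3 * e" by simp
  also have "\<dots> mod 3 = (e + (2 * f + g)) mod 3" by (rule mod_mult_self2)
  also have "\<dots> = (e + (2 * f + g) mod 3) mod 3" by (rule mod_add_right_eq[symmetric])
  finally have odd_odd: "(2 * ((2 * e + f) mod 3) + g) mod 3 = (e + (2 * f + g) mod 3) mod 3" .
  have even_odd: "(2 * ((e + f) mod 3) + g) mod 3 = (2 * e + (2 * f + g) mod 3) mod 3"
    by (metis add.assoc distrib_left mod_add_left_eq mod_add_right_eq mod_mult_right_eq)
  have even: "((h + f) mod 3 + g) mod 3 = (h + (f + g) mod 3) mod 3" for h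
    by (simp add: mod_add_left_eq mod_add_right_eq add.assoc)
  have idx: "((i + j) mod (2 * n) + k) mod (2 * n) = (i + (j + k) mod (2 * n)) mod (2 * n)"
    by (simp add: mod_add_left_eq mod_add_right_eq add.assoc)
  show "x \<otimes>\<^bsub>U6n n\<^esub> y \<otimes>\<^bsub>U6n n\<^esub> z = x \<otimes>\<^bsub>U6n n\<^esub> (y \<otimes>\<^bsub>U6n n\<^esub> z)"
    unfolding x y z U6n_mult
    by (cases "even j"; cases "even k")
      (simp_all only: idx even odd_odd even_odd even_mod_double even_add if_True if_False simp_thms)
next
  fix x assume "x \<in> carrier (U6n n)"
  then show "\<one>\<^bsub>U6n n\<^esub> \<otimes>\<^bsub>U6n n\<^esub> x = x"
    by (cases x) (simp add: U6n_carrier U6n_mult U6n_one)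
next
  fix x assume x: "x \<in> carrier (U6n n)"
  obtain i e where ie: "x = (i, e)" by (cases x)
  \<comment> \<open>For odd \<open>i\<close> the inverse keeps \<open>e\<close>, since
    \<open>2 * e + e\<close> is 0 modulo 3.\<close>
  define y where "y = ((2 * n - i) mod (2 * n), if even i then (3 - e) mod 3 else e)"
  have "y \<in> carrier (U6n n)" using x n by (auto simp: ie y_def U6n_carrier)
  moreover have "y \<otimes>\<^bsub>U6n n\<^esub> x = \<one>\<^bsub>U6n n\<^esub>"
    using x by (auto simp: ie y_def U6n_carrier U6n_mult U6n_one mod_simps)
  ultimately show "\<exists>y\<in>carrier (U6n n). y \<otimes>\<^bsub>U6n n\<^esub> x = \<one>\<^bsub>U6n n\<^esub>" by blast
qed

lemma finite_U6n: "finite (carrier (U6n n))"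
  by (simp add: U6n_carrier)

lemma chi_mult: "n \<ge> 1 \<Longrightarrow> chi n k (x \<otimes>\<^bsub>U6n n\<^esub> y) = chi n k x * chi n k y"
  by (cases x, cases y)
    (simp add: chi_def U6n_mult power_mult_mod[OF omega_power] power_add add_mult_distrib2)

text \<open>Closure under inverses makes the products \<open>s \<otimes> x\<close> all the
  neighbours of \<open>x\<close>; by cancellation each is counted once.\<close>

lemma (in group) cayley_adj_sum:
  fixes v :: "'a \<Rightarrow> complex"
  assumes fin: "finite (carrier G)" and S: "S \<subseteq> carrier G" "(\<lambda>x. inv x) ` S = S"
    and x: "x \<in> carrier G"
  shows "(\<Sum>y\<in>carrier G. (if cayley_adj G S x y then 1 else 0) * v y) = (\<Sum>s\<in>S. v (s \<otimes> x))"
proof -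
  have adj: "cayley_adj G S x y \<longleftrightarrow> y \<in> (\<lambda>s. s \<otimes> x) ` S" if y: "y \<in> carrier G" for y
  proof -
    have "y \<in> (\<lambda>s. s \<otimes> x) ` S" if s: "s \<in> S" "x = s \<otimes> y" for s
    proof (rule image_eqI[of _ _ "inv s"])
      show "inv s \<in> S" using s S by blast
      have "s \<in> carrier G" using s S by blast
      then show "y = inv s \<otimes> x" unfolding s(2) using y by (simp add: m_assoc[symmetric])
    qed
    then show ?thesis unfolding cayley_adj_def by blast
  qed
  have "(\<Sum>y\<in>carrier G. (if cayley_adj G S x y then 1 else 0) * v y) =
      (\<Sum>y\<in>carrier G. if y \<in> (\<lambda>s. s \<otimes> x) ` S then v y else 0)"
    using adj by (intro sum.cong) auto
  also have "\<dots> = sum v (carrier G \<inter> (\<lambda>s. s \<otimes> x) ` S)"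
    using fin by (simp add: sum.inter_restrict)
  also have "carrier G \<inter> (\<lambda>s. s \<otimes> x) ` S = (\<lambda>s. s \<otimes> x) ` S"
    using S x by auto
  also have "sum v \<dots> = (\<Sum>s\<in>S. v (s \<otimes> x))"
    using S x by (subst sum.reindex) (auto simp: inj_on_def subset_iff)
  finally show ?thesis .
qed

text \<open>Fourier inversion first in the exponent of \<open>a\<close>, then in that of
  \<open>b\<close>.\<close>

lemma fourier_zero_U6n:
  fixes v :: "nat \<times> nat \<Rightarrow> complex"
  assumes n: "n \<ge> 1"
    and v: "\<And>k t. k < 2 * n \<Longrightarrow> t < 3 \<Longrightarrow>
      (\<Sum>(i, e)\<in>carrier (U6n n). v (i, e) * (omega n ^ (k * i) * zeta3 ^ (t * e))) = 0"
    and x: "x \<in> carrier (U6n n)"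
  shows "v x = 0"
proof -
  obtain i e where ie: "x = (i, e)" "i < 2 * n" "e < 3"
    using x by (auto simp: U6n_carrier)
  have inner: "(\<Sum>e<3. v (i, e) * zeta3 ^ (t * e)) = 0" if t: "t < 3" for t
  proof (rule fourier_zero[where \<xi> = "omega n" and N = "2 * n" and j = i
        and f = "\<lambda>i. \<Sum>e<3. v (i, e) * zeta3 ^ (t * e)"])
    show "omega n ^ (2 * n) = 1" by (rule omega_power[OF n])
    show "omega n ^ j \<noteq> 1" if "0 < j" "j < 2 * n" for j
      unfolding omega_eq using that by (intro cis_primitive_root) auto
    show "(\<Sum>i<2*n. (\<Sum>e<3. v (i, e) * zeta3 ^ (t * e)) * omega n ^ (k * i)) = 0" if "k < 2 * n" for k
      using v[OF that t]
      by (simp add: U6n_carrier sum.cartesian_product[symmetric] sum_distrib_left sum_distrib_right atLeast0LessThan mult_ac)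
  qed (rule ie)
  have "v (i, e) = 0"
  proof (rule fourier_zero[where \<xi> = zeta3 and N = 3 and j = e and f = "\<lambda>e. v (i, e)"])
    show "zeta3 ^ 3 = 1" by (rule zeta3_power_3)
    show "zeta3 ^ j \<noteq> 1" if "0 < j" "j < 3" for j
      unfolding zeta3_def using that by (intro cis_primitive_root) auto
  qed (use inner ie in auto)
  then show ?thesis using ie by simp
qed

section \<open>Block decomposition of the adjacency operator\<close>

definition wave :: "nat \<Rightarrow> nat \<Rightarrow> nat \<Rightarrow> bool \<Rightarrow> nat \<times> nat \<Rightarrow> complex" where
  "wave n k t b x = (if even (fst x) = b then chi n k x * zeta3 ^ (t * snd x) else 0)"

text \<open>For fixed \<open>k\<close> and \<open>t\<close> the two waves span a space invariant under left translations; even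
  elements act diagonally on it and odd elements swap the two waves.\<close>

lemma wave_mult_even:
  assumes "n \<ge> 1" "even i"
  shows "wave n k t b ((i, 0) \<otimes>\<^bsub>U6n n\<^esub> x) = chi n k (i, 0) * wave n k t b x"
proof -
  obtain j f where x: "x = (j, f)" by (cases x)
  show ?thesis
    using assms unfolding wave_def chi_mult[OF assms(1)]
    by (simp add: x U6n_mult even_mod_double power_mult_mod[OF zeta3_power_3])
qed

text \<open>If the flag \<open>b\<close> is true, only odd \<open>x\<close> contribute, and moving
  the power of the group generator past them inverts it, which turns \<open>t\<close> into
  \<open>2 * t\<close>. If it is false, only even \<open>x\<close> contribute and nothing is
  inverted.\<close>

lemma wave_mult_odd:
  assumes "n \<ge> 1" "odd i"
  shows "wave n k t b ((i, e) \<otimes>\<^bsub>U6n n\<^esub> x) =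
    chi n k (i, e) * zeta3 ^ ((if b then 2 * t else t) * e) * wave n k t (\<not> b) x"
proof -
  obtain j f where x: "x = (j, f)" by (cases x)
  show ?thesis
    using assms unfolding wave_def chi_mult[OF assms(1)]
    by (simp add: x U6n_mult even_mod_double power_mult_mod[OF zeta3_power_3] power_add
        add_mult_distrib2 dvd_mod_iff mult_ac)
qed

text \<open>In coordinates, the powers of the square of \<open>a\<close> are the pairs with even
  first and zero second entry; its three cosets at hand together are the pairs with odd first
  entry.\<close>

locale u6n_connection_set =
  fixes n :: nat and S1 S2 :: "(nat \<times> nat) set"
  assumes n: "n \<ge> 1"
    and S1: "\<And>s. s \<in> S1 \<Longrightarrow> fst s < 2 * n \<and> even (fst s) \<and> snd s = 0"
    and S2: "\<And>s. s \<in> S2 \<Longrightarrow> fst s < 2 * n \<and> odd (fst s) \<and> snd s < 3"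
    and inverse_closed: "(\<lambda>x. inv\<^bsub>U6n n\<^esub> x) ` (S1 \<union> S2) = S1 \<union> S2"
begin

abbreviation G where "G \<equiv> U6n n"

sublocale group G by (rule group_U6n[OF n])

abbreviation P where "P k \<equiv> char_set (chi n k) S1"

text \<open>\<open>Q k t\<close> and \<open>Q k (2 * t)\<close> are the off-diagonal entries of the
  block for \<open>k\<close> and \<open>t\<close>.\<close>

definition Q where "Q k t = (\<Sum>s\<in>S2. chi n k s * zeta3 ^ (t * snd s))"

abbreviation adj :: "nat \<times> nat \<Rightarrow> nat \<times> nat \<Rightarrow> complex" where
  "adj x y \<equiv> (if cayley_adj G (S1 \<union> S2) x y then 1 else 0)"

lemma S_carrier: "S1 \<subseteq> carrier G" "S2 \<subseteq> carrier G"
  using S1 S2 by (force simp: U6n_carrier)+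

lemma finite_S: "finite S1" "finite S2"
  using S_carrier finite_U6n finite_subset by blast+

lemma adj_sum:
  assumes "x \<in> carrier G"
  shows "(\<Sum>y\<in>carrier G. adj x y * v y) = (\<Sum>s\<in>S1. v (s \<otimes>\<^bsub>G\<^esub> x)) + (\<Sum>s\<in>S2. v (s \<otimes>\<^bsub>G\<^esub> x))"
proof -
  have "S1 \<inter> S2 = {}" using S1 S2 by blast
  then show ?thesis
    using cayley_adj_sum[OF finite_U6n _ inverse_closed assms, of v] S_carrier finite_S
    by (simp add: sum.union_disjoint)
qed

lemma adj_sum_wave:
  assumes "x \<in> carrier G"
  shows "(\<Sum>y\<in>carrier G. adj x y * wave n k t b y) =
    P k * wave n k t b x + Q k (if b then 2 * t else t) * wave n k t (\<not> b) x"
proof -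
  have "wave n k t b (s \<otimes>\<^bsub>G\<^esub> x) = chi n k s * wave n k t b x" if "s \<in> S1" for s
    using S1[OF that] wave_mult_even[OF n, of "fst s" k t b x] by (cases s) simp
  moreover have "wave n k t b (s \<otimes>\<^bsub>G\<^esub> x) =
      chi n k s * zeta3 ^ ((if b then 2 * t else t) * snd s) * wave n k t (\<not> b) x" if "s \<in> S2" for s
    using S2[OF that] wave_mult_odd[OF n, of "fst s" k t b "snd s" x] by (cases s) simp
  ultimately show ?thesis
    unfolding adj_sum[OF assms] char_set_def Q_def sum_distrib_right by simp
qed

lemma adj_sym: "adj x y = adj y x"
  unfolding cayley_adj_def by auto

text \<open>Moves the operator from an eigenvector onto the waves, where its action is
  known.\<close>

lemma adj_adjoint:
  fixes v g :: "nat \<times> nat \<Rightarrow> complex"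
  shows "(\<Sum>x\<in>carrier G. v x * (\<Sum>y\<in>carrier G. adj x y * g y)) =
    (\<Sum>x\<in>carrier G. (\<Sum>y\<in>carrier G. adj x y * v y) * g x)"
  unfolding sum_distrib_left sum_distrib_right
  by (subst sum.swap, intro sum.cong refl, subst adj_sym) (simp add: mult_ac)

definition eigenvalue_of_graph :: "complex \<Rightarrow> bool" where
  "eigenvalue_of_graph \<mu> \<longleftrightarrow> (\<exists>v. (\<exists>x\<in>carrier G. v x \<noteq> 0) \<and>
    (\<forall>x\<in>carrier G. (\<Sum>y\<in>carrier G. adj x y * v y) = \<mu> * v x))"

lemma eigenvalue_of_graphI:
  assumes \<mu>: "(\<mu> - P k)\<^sup>2 = Q k t * Q k (2 * t)"
  shows "eigenvalue_of_graph \<mu>"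
proof -
  \<comment> \<open>An eigenvector of the block: \<open>\<alpha> = Q k t\<close> and
    \<open>\<beta> = \<mu> - P k\<close>, or \<open>\<alpha> = 0\<close> and
    \<open>\<beta> = 1\<close> if both of these vanish.\<close>
  obtain \<alpha> \<beta> where ab: "\<beta> * Q k t = (\<mu> - P k) * \<alpha>" "\<alpha> * Q k (2 * t) = (\<mu> - P k) * \<beta>"
    and nz: "\<alpha> \<noteq> 0 \<or> \<beta> \<noteq> 0"
  proof (cases "Q k t = 0 \<and> \<mu> = P k")
    case True
    then show ?thesis by (intro that[of 1 0]) auto
  next
    case False
    then show ?thesis using \<mu> by (intro that[of "\<mu> - P k" "Q k t"]) (auto simp: power2_eq_square)
  qed
  define v where "v x = \<alpha> * wave n k t True x + \<beta> * wave n k t False x" for x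
  \<comment> \<open>Each of the two points sees only one wave, so together they detect a nonzero
    coefficient.\<close>
  have "v (0, 0) = \<alpha>" "v (1, 0) = \<beta> * omega n ^ k"
    by (simp_all add: v_def wave_def chi_def)
  moreover have "omega n \<noteq> 0" by (simp add: omega_def)
  moreover have "(0, 0) \<in> carrier G" "(1, 0) \<in> carrier G"
    using n by (simp_all add: U6n_carrier)
  ultimately have "\<exists>x\<in>carrier G. v x \<noteq> 0" using nz by (metis mult_eq_0_iff power_eq_0_iff)
  moreover have "(\<Sum>y\<in>carrier G. adj x y * v y) = \<mu> * v x" if x: "x \<in> carrier G" for x
  proof -
    have "(\<Sum>y\<in>carrier G. adj x y * v y) =
        \<alpha> * (\<Sum>y\<in>carrier G. adj x y * wave n k t True y) +
        \<beta> * (\<Sum>y\<in>carrier G. adj x y * wave n k t False y)"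
      unfolding v_def sum_distrib_left by (simp add: sum.distrib[symmetric] algebra_simps)
    also have "\<dots> = (P k * \<alpha> + \<beta> * Q k t) * wave n k t True x +
        (P k * \<beta> + \<alpha> * Q k (2 * t)) * wave n k t False x"
      unfolding adj_sum_wave[OF x] by (simp add: algebra_simps)
    also have "\<dots> = \<mu> * v x" unfolding ab v_def by (simp add: algebra_simps)
    finally show ?thesis .
  qed
  ultimately show ?thesis unfolding eigenvalue_of_graph_def by blast
qed

lemma eigenvalue_of_graphD:
  assumes "eigenvalue_of_graph \<mu>"
  shows "\<exists>k<2*n. \<exists>t<3. (\<mu> - P k)\<^sup>2 = Q k t * Q k (2 * t)"
proof -
  obtain v where v: "\<exists>x\<in>carrier G. v x \<noteq> 0"
    "\<And>x. x \<in> carrier G \<Longrightarrow> (\<Sum>y\<in>carrier G. adj x y * v y) = \<mu> * v x"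
    using assms unfolding eigenvalue_of_graph_def by blast
  \<comment> \<open>The pairings of \<open>v\<close> with the two waves satisfy the equations of the
    transposed block; a nonzero pair forces its determinant condition.\<close>
  define c where "c k t b = (\<Sum>x\<in>carrier G. v x * wave n k t b x)" for k t b
  have c: "\<mu> * c k t b = P k * c k t b + Q k (if b then 2 * t else t) * c k t (\<not> b)" for k t b
  proof -
    have "\<mu> * c k t b = (\<Sum>x\<in>carrier G. (\<Sum>y\<in>carrier G. adj x y * v y) * wave n k t b x)"
      unfolding c_def sum_distrib_left using v(2) by (intro sum.cong) (simp_all add: mult.assoc)
    also have "\<dots> = (\<Sum>x\<in>carrier G. v x * (\<Sum>y\<in>carrier G. adj x y * wave n k t b y))"
      by (rule adj_adjoint[symmetric])
    also have "\<dots> = (\<Sum>x\<in>carrier G. v x *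
        (P k * wave n k t b x + Q k (if b then 2 * t else t) * wave n k t (\<not> b) x))"
      using adj_sum_wave by (intro sum.cong) simp_all
    finally show ?thesis
      unfolding c_def by (simp add: sum_distrib_left sum.distrib algebra_simps)
  qed
  \<comment> \<open>The even and the odd wave add up to a full Fourier mode, so vanishing of all
    these sums would make \<open>v\<close> zero on the group.\<close>
  have "\<exists>k<2*n. \<exists>t<3. c k t True + c k t False \<noteq> 0"
  proof (rule ccontr)
    assume "\<not> ?thesis"
    then have zero: "c k t True + c k t False = 0" if "k < 2 * n" "t < 3" for k t
      using that by blast
    have "(\<Sum>(i, e)\<in>carrier G. v (i, e) * (omega n ^ (k * i) * zeta3 ^ (t * e))) =
        c k t True + c k t False" for k t
      unfolding c_def sum.distrib[symmetric]
      by (intro sum.cong) (auto simp: wave_def chi_def)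
    then have "v x = 0" if "x \<in> carrier G" for x
      using zero that by (intro fourier_zero_U6n[OF n, of v]) simp_all
    then show False using v(1) by blast
  qed
  then obtain k t where kt: "k < 2 * n" "t < 3" and nz: "c k t True \<noteq> 0 \<or> c k t False \<noteq> 0"
    by fastforce
  have c1: "(\<mu> - P k) * c k t True = Q k (2 * t) * c k t False"
    and c2: "(\<mu> - P k) * c k t False = Q k t * c k t True"
    using c[of k t True] c[of k t False] by (simp_all add: algebra_simps)
  have "(\<mu> - P k)\<^sup>2 * c k t True = Q k (2 * t) * ((\<mu> - P k) * c k t False)"
    unfolding power2_eq_square mult.assoc c1 by (rule mult.left_commute)
  moreover have "(\<mu> - P k)\<^sup>2 * c k t False = Q k t * ((\<mu> - P k) * c k t True)"
    unfolding power2_eq_square mult.assoc c2 by (rule mult.left_commute)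
  ultimately have "(\<mu> - P k)\<^sup>2 = Q k t * Q k (2 * t)"
    using nz unfolding c1 c2 by auto
  then show ?thesis using kt by blast
qed

end

section \<open>Integrality\<close>

text \<open>As \<open>2 * m\<close> is \<open>- m\<close> modulo 3, this is the value of a
  degree-two character at the \<open>m\<close>-th power of \<open>b\<close>; the -1 comes from
  \<open>zeta3 ^ 2 + zeta3 + 1 = 0\<close>.\<close>

lemma zeta3_power_add_power_double:
  "zeta3 ^ m + zeta3 ^ (2 * m) = (if m mod 3 = 0 then 2 else -1)"
proof -
  have "zeta3 \<noteq> 1"
    using cis_primitive_root(2)[of 3 1] by (simp add: zeta3_def)
  moreover have "(zeta3 - 1) * (zeta3 ^ 2 + zeta3 + 1) = zeta3 ^ 3 - 1"
    by (simp add: algebra_simps power2_eq_square power3_eq_cube)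
  ultimately have sum0: "zeta3 ^ 2 + zeta3 + 1 = 0" using zeta3_power_3 by simp
  have red: "zeta3 ^ m = zeta3 ^ (m mod 3)" "zeta3 ^ (2 * m) = zeta3 ^ (2 * (m mod 3))"
    using power_mult_mod[OF zeta3_power_3, of 1 m] power_mult_mod[OF zeta3_power_3, of 2 m] by simp_all
  have four: "zeta3 ^ 4 = zeta3"
    using power_add[of zeta3 3 1] zeta3_power_3 by simp
  have "m mod 3 < 3" by simp
  then consider "m mod 3 = 0" | "m mod 3 = 1" | "m mod 3 = 2" by linarith
  then show ?thesis
  proof cases
    case 1
    then show ?thesis unfolding red by simp
  next
    case 2
    then show ?thesis unfolding red using sum0 by (simp add: eq_neg_iff_add_eq_0 power2_eq_square add_ac)
  next
    case 3
    then show ?thesis unfolding red using sum0 four by (simp add: eq_neg_iff_add_eq_0 add_ac)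
  qed
qed

text \<open>The product of two odd elements is even with \<open>b\<close>-exponent
  \<open>2 * e + f\<close>; writing the value 2 or -1 as two powers of \<open>zeta3\<close>
  separates the variables \<open>x\<close> and \<open>y\<close>.\<close>

lemma psi_mult_odd:
  assumes n: "n \<ge> 1" and x: "odd (fst x)" and y: "odd (fst y)"
  shows "psi n k (x \<otimes>\<^bsub>U6n n\<^esub> y) = chi n k x * chi n k y *
    (zeta3 ^ (2 * snd x + snd y) + zeta3 ^ (snd x + 2 * snd y))"
proof -
  obtain i e where ie: "x = (i, e)" by (cases x)
  obtain j f where jf: "y = (j, f)" by (cases y)
  have ev: "even (i + j)" "odd j" using x y ie jf by auto
  have "2 * (2 * e + f) = (e + 2 * f) + 3 * e" by simp
  then have "zeta3 ^ (2 * (2 * e + f)) = zeta3 ^ (e + 2 * f)"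
    by (simp only: power_add power_mult zeta3_power_3) simp
  then have zeta: "zeta3 ^ (2 * e + f) + zeta3 ^ (e + 2 * f) = (if (2 * e + f) mod 3 = 0 then 2 else -1)"
    using zeta3_power_add_power_double[of "2 * e + f"] by simp
  have omega: "omega n ^ (k * ((i + j) mod (2 * n))) = chi n k x * chi n k y"
    unfolding power_mult_mod[OF omega_power[OF n]] ie jf chi_def
    by (simp add: add_mult_distrib2 power_add)
  have "psi n k (x \<otimes>\<^bsub>U6n n\<^esub> y) = chi n k x * chi n k y * (if (2 * e + f) mod 3 = 0 then 2 else -1)"
    unfolding psi_def ie jf U6n_mult
    using ev omega[unfolded ie jf] by (simp add: even_mod_double del: even_add)
  then show ?thesis unfolding zeta[symmetric] by (simp add: ie jf)
qed

text \<open>Both roots are powers of \<open>\<xi>\<close>, so all character sums lie in one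
  ring.\<close>

lemma cyclotomic_int_adjoin:
  assumes n: "n \<ge> 1"
  defines "\<xi> \<equiv> cis (2 * pi / real (6 * n))"
  shows "\<xi> ^ (6 * n) = 1" and "omega n \<in> int_adjoin \<xi>" and "zeta3 \<in> int_adjoin \<xi>"
proof -
  show "\<xi> ^ (6 * n) = 1"
    unfolding \<xi>_def using n by (intro cis_primitive_root) simp
  have "omega n = \<xi> ^ 3"
    unfolding \<xi>_def omega_eq using n by (simp add: DeMoivre field_simps)
  moreover have "zeta3 = \<xi> ^ (2 * n)"
    unfolding \<xi>_def zeta3_def using n by (simp add: DeMoivre field_simps)
  ultimately show "omega n \<in> int_adjoin \<xi>" "zeta3 \<in> int_adjoin \<xi>"
    by (metis int_adjoin_power int_adjoin.gen)+
qed

section \<open>Changing the generator of a cyclic subgroup\<close>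

text \<open>Modulo \<open>N\<close> the additive order of \<open>i\<close> is
  \<open>N div gcd i N\<close>, and \<open>l\<close> inverts \<open>m\<close> modulo that order. A
  common prime \<open>p\<close> would make \<open>p * gcd i N\<close> divide both \<open>i\<close>
  and \<open>N\<close>.\<close>

lemma coprime_of_mult_cong_self:
  fixes m l i N :: nat
  assumes "[m * l * i = i] (mod N)" "N > 0"
  shows "coprime m (N div gcd i N)"
proof (rule ccontr)
  assume "\<not> coprime m (N div gcd i N)"
  then have "gcd m (N div gcd i N) \<noteq> 1" by (simp add: coprime_iff_gcd_eq_1)
  then obtain p where p: "Factorial_Ring.prime p" "p dvd gcd m (N div gcd i N)"
    using prime_factor_nat by blast
  let ?d = "gcd i N"
  have d0: "?d > 0" using assms(2) by simp
  have "p * ?d dvd (N div ?d) * ?d" using p(2) by (intro mult_dvd_mono) auto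
  then have N: "p * ?d dvd N" by simp
  have "p * ?d dvd m * i" using p(2) by (intro mult_dvd_mono) auto
  then have "p * ?d dvd m * i * l" by (rule dvd_mult2)
  then have "p * ?d dvd m * l * i" by (simp only: mult_ac)
  moreover have "[m * l * i = i] (mod p * ?d)"
    using assms(1) N by (rule cong_dvd_modulus_nat)
  ultimately have "p * ?d dvd i" using cong_dvd_iff by blast
  then have "p * ?d dvd ?d" using N by (rule gcd_greatest)
  then have "p * ?d \<le> 1 * ?d" using d0 dvd_imp_le by force
  then have "p \<le> 1" using d0 mult_le_cancel2 by blast
  then show False using prime_gt_1_nat[OF p(1)] by linarith
qed

text \<open>Modulo \<open>N\<close>, a multiple of \<open>i\<close> depends on the multiplier only
  modulo the additive order of \<open>i\<close>.\<close>

lemma mult_cong_of_cong_div_gcd: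
  fixes u m i N :: nat
  assumes "[u = m] (mod N div gcd i N)"
  shows "[u * i = m * i] (mod N)"
proof -
  let ?d = "gcd i N"
  have "[?d * u = ?d * m] (mod ?d * (N div ?d))"
    using assms by (rule cong_cmult_leftI)
  then have "[?d * u = ?d * m] (mod N)" by simp
  then have "[?d * u * (i div ?d) = ?d * m * (i div ?d)] (mod N)" by (rule cong_scalar_right)
  moreover have "?d * w * (i div ?d) = w * i" for w
  proof -
    have "?d * w * (i div ?d) = w * (?d * (i div ?d))" by (simp only: mult_ac)
    then show ?thesis by simp
  qed
  ultimately show ?thesis by simp
qed

context u6n_connection_set
begin

lemma pow_even:
  assumes "even i"
  shows "(i mod (2 * n), 0) [^]\<^bsub>G\<^esub> (m :: nat) = (m * i mod (2 * n), 0)"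
proof (induction m)
  case 0
  then show ?case by (simp add: U6n_one)
next
  case (Suc m)
  then show ?case
    using assms by (simp add: U6n_mult even_mod_double mod_simps add.commute)
qed

lemma Q_0: "Q k 0 = char_set (chi n k) S2"
  by (simp add: Q_def char_set_def)

text \<open>The block for \<open>t = 2\<close> has the entries \<open>Q k 2\<close> and
  \<open>Q k 4\<close>; this reduces it to \<open>t = 1\<close>.\<close>

lemma Q_4: "Q k 4 = Q k 1"
proof -
  have "zeta3 ^ (4 * e) = zeta3 ^ (1 * e)" for e
  proof -
    have "4 * e = e + 3 * e" by simp
    then show ?thesis by (simp only: power_add power_mult zeta3_power_3) simp
  qed
  then show ?thesis by (simp add: Q_def)
qed

text \<open>Each of the two terms of \<open>psi_mult_odd\<close> turns the double sum into a product
  of single sums.\<close>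

lemma char_set_sq_psi: "char_set_sq n (psi n k) S2 = 2 * (Q k 1 * Q k 2)"
proof -
  have expand: "Q k a * Q k b =
      (\<Sum>x\<in>S2. \<Sum>y\<in>S2. chi n k x * chi n k y * zeta3 ^ (a * snd x + b * snd y))" for a b
    unfolding Q_def sum_product by (simp add: power_add mult_ac)
  have "char_set_sq n (psi n k) S2 = (\<Sum>x\<in>S2. \<Sum>y\<in>S2. chi n k x * chi n k y *
      (zeta3 ^ (2 * snd x + snd y) + zeta3 ^ (snd x + 2 * snd y)))"
    unfolding char_set_sq_def using S2 psi_mult_odd[OF n] by (intro sum.cong) auto
  also have "\<dots> = Q k 2 * Q k 1 + Q k 1 * Q k 2"
    unfolding expand by (simp add: distrib_left sum.distrib)
  finally show ?thesis by (simp add: mult.commute)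
qed

lemma Ints_of_Rats_int_adjoin:
  assumes "x \<in> int_adjoin (cis (2 * pi / real (6 * n)))" "x \<in> \<rat>"
  shows "x \<in> \<int>"
  using n by (intro int_adjoin_Rats_imp_Ints[OF cyclotomic_int_adjoin(1)[OF n] _ assms]) simp

lemma chi_int_adjoin: "chi n k s \<in> int_adjoin (cis (2 * pi / real (6 * n)))"
  unfolding chi_def case_prod_beta by (intro int_adjoin_power cyclotomic_int_adjoin n)

lemma P_int_adjoin: "P k \<in> int_adjoin (cis (2 * pi / real (6 * n)))"
  unfolding char_set_def by (intro int_adjoin_sum chi_int_adjoin)

lemma Q_int_adjoin: "Q k t \<in> int_adjoin (cis (2 * pi / real (6 * n)))"
  unfolding Q_def
  by (intro int_adjoin_sum int_adjoin.mult chi_int_adjoin int_adjoin_power cyclotomic_int_adjoin n)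

text \<open>Since \<open>m\<close> matters only modulo the order of \<open>x\<close>, it may be replaced by some \<open>u\<close> without
  small prime factors. Then \<open>P (u * k) = P k\<close>, so \<open>S1\<close> and its image under \<open>u\<close>-th powers have the
  same Fourier transform.\<close>

lemma S1_power_closed:
  assumes P: "\<And>k. P k \<in> \<int>"
    and x: "x \<in> S1" and y: "y = x [^]\<^bsub>G\<^esub> (m :: nat)" "x = y [^]\<^bsub>G\<^esub> (l :: nat)"
  shows "y \<in> S1"
proof -
  obtain i where i: "x = (i, 0)" "i < 2 * n" "even i" using S1[OF x] by (cases x) auto
  define N where "N = 2 * n"
  have N: "N > 0" using n by (simp add: N_def)
  have y': "y = (m * i mod N, 0)"
    using y(1) pow_even[OF i(3), of m] i by (simp add: N_def)
  have "even (m * i)" using i(3) by simp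
  from pow_even[OF this, of l] have "i = l * (m * i) mod N"
    using y(2) y' i(1) by (simp add: N_def)
  then have "[m * l * i = i] (mod N)" using i(2) by (simp add: cong_def N_def mult_ac)
  then have "coprime m (N div gcd i N)" using N by (rule coprime_of_mult_cong_self)
  then obtain u where u: "u mod (N div gcd i N) = m mod (N div gcd i N)"
      "coprime u (fact (2 * card S1) :: nat)"
    using exists_cong_coprime[of m "N div gcd i N" "fact (2 * card S1)"] by auto
  have ui: "u * i mod N = m * i mod N"
    using mult_cong_of_cong_div_gcd[of u m N i] u(1) by (simp add: cong_def)
  \<comment> \<open>0 is coprime only to 1, but the factorial is even since \<open>S1\<close> is
    nonempty.\<close>
  have "card S1 > 0" using x finite_S card_gt_0_iff by blast
  then have "2 dvd (fact (2 * card S1) :: nat)" by (intro dvd_fact) auto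
  then have "u > 0" using u(2) by (intro Nat.gr0I) auto
  have P_eq: "P k = (\<Sum>s\<in>S1. omega n ^ (k * fst s))" for k
    by (simp add: char_set_def chi_def case_prod_beta)
  have Pu: "P (u * k) = P k" for k
    unfolding P_eq
    using sum_roots_of_unity_coprime_multiple[OF omega_power[OF n] _ finite_S(1), of fst u k]
      P u(2) \<open>u > 0\<close> n unfolding P_eq by simp
  \<comment> \<open>\<open>f j\<close> counts the elements of \<open>S1\<close> that multiplication
    by \<open>u\<close> sends to \<open>j\<close>, minus those already at \<open>j\<close>; its
    Fourier transform is \<open>P (u * k) - P k\<close>.\<close>
  define f :: "nat \<Rightarrow> complex"
    where "f j = (\<Sum>s\<in>S1. of_bool (u * fst s mod N = j) - of_bool (fst s = j))" for j
  have "f (m * i mod N) = 0"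
  proof (rule fourier_zero[where \<xi> = "omega n" and N = N])
    show "omega n ^ N = 1" unfolding N_def by (rule omega_power[OF n])
    show "omega n ^ j \<noteq> 1" if "0 < j" "j < N" for j
      unfolding omega_eq using that N_def by (intro cis_primitive_root) auto
    show "(\<Sum>j<N. f j * omega n ^ (k * j)) = 0" for k
    proof -
      have "(\<Sum>j<N. f j * omega n ^ (k * j)) = (\<Sum>s\<in>S1. \<Sum>j<N.
          (of_bool (u * fst s mod N = j) - of_bool (fst s = j)) * omega n ^ (k * j))"
        unfolding f_def sum_distrib_right by (rule sum.swap)
      also have "\<dots> = (\<Sum>s\<in>S1. omega n ^ (k * (u * fst s mod N)) - omega n ^ (k * fst s))"
      proof (intro sum.cong refl)
        fix s assume "s \<in> S1"
        then have "fst s < N" using S1 N_def by blast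
        then show "(\<Sum>j<N. (of_bool (u * fst s mod N = j) - of_bool (fst s = j)) * omega n ^ (k * j)) =
            omega n ^ (k * (u * fst s mod N)) - omega n ^ (k * fst s)"
          using N by (simp add: left_diff_distrib sum_subtractf of_bool_def
              if_distrib[of "\<lambda>x. x * _"] cong: if_cong)
      qed
      also have "\<dots> = P (u * k) - P k"
        unfolding P_eq sum_subtractf N_def power_mult_mod[OF omega_power[OF n]]
        by (simp add: mult_ac)
      finally show ?thesis using Pu by simp
    qed
    show "m * i mod N < N" using N by simp
  qed
  then have "of_nat (card {s \<in> S1. u * fst s mod N = m * i mod N}) =
      (of_nat (card {s \<in> S1. fst s = m * i mod N}) :: complex)"
    unfolding f_def sum_subtractf using finite_S
    by (simp add: sum_of_bool_eq Int_def)
  \<comment> \<open>The first count includes \<open>x\<close>, so the second is positive too, and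
    only \<open>y\<close> can account for it.\<close>
  moreover have "x \<in> {s \<in> S1. u * fst s mod N = m * i mod N}"
    using x ui i by simp
  then have "card {s \<in> S1. u * fst s mod N = m * i mod N} > 0"
    using finite_S(1) card_gt_0_iff by fastforce
  ultimately have "card {s \<in> S1. fst s = m * i mod N} > 0" by simp
  then have "{s \<in> S1. fst s = m * i mod N} \<noteq> {}" using card_gt_0_iff by blast
  then obtain s where s: "s \<in> S1" "fst s = m * i mod N" by blast
  then have "s = y" using S1[OF s(1)] y' by (simp add: prod_eq_iff)
  then show ?thesis using s(1) by simp
qed

text \<open>One direction sums the homomorphisms \<open>chi n k\<close> over \<open>S1\<close>. For
  the other, two generators of the same finite cyclic group are powers of each other, so
  \<open>S1_power_closed\<close> applies.\<close>

lemma bool_alg_iff_P_Ints: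
  assumes H: "subgroup H G" and S1H: "S1 \<subseteq> H"
  shows "S1 \<in> bool_alg (G\<lparr>carrier := H\<rparr>) \<longleftrightarrow> (\<forall>k. P k \<in> \<int>)"
proof -
  interpret HG: group "G\<lparr>carrier := H\<rparr>" by (rule subgroup_imp_group[OF H])
  have fin: "finite (carrier (G\<lparr>carrier := H\<rparr>))"
    using subgroup.subset[OF H] finite_U6n finite_subset by auto
  show ?thesis
  proof
    assume "S1 \<in> bool_alg (G\<lparr>carrier := H\<rparr>)"
    then show "\<forall>k. P k \<in> \<int>"
      unfolding char_set_def using chi_mult[OF n]
      by (intro allI HG.sum_hom_bool_alg_Ints[OF fin]) simp_all
  next
    assume P: "\<forall>k. P k \<in> \<int>"
    have "y \<in> S1"
      if x: "x \<in> S1" and y: "y \<in> H"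
        and eq: "generate (G\<lparr>carrier := H\<rparr>) {x} = generate (G\<lparr>carrier := H\<rparr>) {y}" for x y
    proof -
      have pow: "generate (G\<lparr>carrier := H\<rparr>) {z} = {z [^]\<^bsub>G\<^esub> k |k. k \<in> (UNIV :: nat set)}" if "z \<in> H" for z
        using HG.generate_pow_on_finite_carrier[OF fin, of z] that by (simp add: nat_pow_consistent[symmetric])
      have "y \<in> generate (G\<lparr>carrier := H\<rparr>) {y}" "x \<in> generate (G\<lparr>carrier := H\<rparr>) {x}"
        by (auto intro: generate.incl)
      then have "y \<in> generate (G\<lparr>carrier := H\<rparr>) {x}" "x \<in> generate (G\<lparr>carrier := H\<rparr>) {y}"
        using eq by simp_all
      then obtain m l :: nat where "y = x [^]\<^bsub>G\<^esub> m" "x = y [^]\<^bsub>G\<^esub> l"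
        using pow x y S1H by blast
      then show ?thesis using S1_power_closed P x by blast
    qed
    then show "S1 \<in> bool_alg (G\<lparr>carrier := H\<rparr>)"
      unfolding HG.bool_alg_iff[OF fin] using S1H by auto
  qed
qed

section \<open>From integral eigenvalues to the character conditions\<close>

lemma integral_graph_iff_eigenvalues:
  "integral_graph (carrier G) (cayley_adj G (S1 \<union> S2)) \<longleftrightarrow> (\<forall>\<mu>. eigenvalue_of_graph \<mu> \<longrightarrow> \<mu> \<in> \<int>)"
  unfolding integral_graph_def eigenvalue_of_graph_def ..

text \<open>Since \<open>omega n ^ n = -1\<close>, the shift changes signs on odd elements only. The
  product \<open>Q k 1 * Q k 2\<close> is thus unchanged, and conditions for \<open>k < n\<close>
  reach all blocks.\<close>

lemma P_Q_shift:
  shows "P (k + n) = P k" and "Q (k + n) t = - Q k t"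
proof -
  have half: "omega n ^ n = -1"
    unfolding omega_eq using n by (simp add: DeMoivre)
  have chi: "chi n (k + n) s = (-1) ^ fst s * chi n k s" for s
    by (cases s) (simp add: chi_def add_mult_distrib power_add power_mult half)
  show "P (k + n) = P k"
    unfolding char_set_def using S1 by (intro sum.cong) (auto simp: chi)
  show "Q (k + n) t = - Q k t"
    unfolding Q_def sum_negf[symmetric] using S2 by (intro sum.cong) (auto simp: chi)
qed

lemma integral_graph_iff_P_Q:
  "integral_graph (carrier G) (cayley_adj G (S1 \<union> S2)) \<longleftrightarrow>
    (\<forall>k. P k \<in> \<int>) \<and> (\<forall>j<2*n. char_set (chi n j) S2 \<in> \<int>) \<and>
    (\<forall>k<n. \<exists>m::int. 2 * char_set_sq n (psi n k) S2 = of_int (m^2))"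
  unfolding integral_graph_iff_eigenvalues
proof (intro iffI conjI allI impI)
  assume int: "\<forall>\<mu>. eigenvalue_of_graph \<mu> \<longrightarrow> \<mu> \<in> \<int>"
  have eig: "P k + csqrt (Q k 1 * Q k 2) \<in> \<int>" "P k - csqrt (Q k 1 * Q k 2) \<in> \<int>" for k
    using int eigenvalue_of_graphI[of _ k 1] by simp_all
  \<comment> \<open>The two eigenvalues for \<open>t = 1\<close> sum to \<open>2 * P k\<close>, so
    \<open>P k\<close> is rational; membership in the ring removes the denominator.\<close>
  show P: "P k \<in> \<int>" for k
  proof (rule Ints_of_Rats_int_adjoin[OF P_int_adjoin])
    have "(P k + csqrt (Q k 1 * Q k 2)) + (P k - csqrt (Q k 1 * Q k 2)) \<in> \<int>"
      by (rule Ints_add[OF eig])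
    then obtain z where "2 * P k = of_int z" by (auto elim: Ints_cases)
    then have "P k = of_int z / of_int 2" by (simp add: field_simps)
    then show "P k \<in> \<rat>" by (metis Rats_divide Rats_of_int)
  qed
  show "char_set (chi n j) S2 \<in> \<int>" for j
  proof -
    \<comment> \<open>For \<open>t = 0\<close> both off-diagonal entries equal
      \<open>char_set (chi n j) S2\<close>.\<close>
    have "P j + char_set (chi n j) S2 \<in> \<int>"
      using int eigenvalue_of_graphI[of _ j 0] by (simp add: Q_0 power2_eq_square)
    from Ints_diff[OF this P[of j]] show ?thesis by simp
  qed
  show "\<exists>m::int. 2 * char_set_sq n (psi n k) S2 = of_int (m^2)" for k
  proof -
    have "csqrt (Q k 1 * Q k 2) \<in> \<int>"
      using Ints_diff[OF eig(1)[of k] P[of k]] by simp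
    then obtain m where m: "csqrt (Q k 1 * Q k 2) = of_int m" by (auto elim: Ints_cases)
    have "2 * char_set_sq n (psi n k) S2 = 4 * (csqrt (Q k 1 * Q k 2))\<^sup>2"
      by (simp add: char_set_sq_psi)
    also have "\<dots> = of_int ((2 * m)\<^sup>2)" unfolding m by simp
    finally show ?thesis by (intro exI)
  qed
next
  fix \<mu>
  assume asm: "(\<forall>k. P k \<in> \<int>) \<and> (\<forall>j<2*n. char_set (chi n j) S2 \<in> \<int>) \<and>
    (\<forall>k<n. \<exists>m::int. 2 * char_set_sq n (psi n k) S2 = of_int (m^2))"
    and eig: "eigenvalue_of_graph \<mu>"
  obtain k t where kt: "k < 2 * n" "t < 3" and \<mu>: "(\<mu> - P k)\<^sup>2 = Q k t * Q k (2 * t)"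
    using eigenvalue_of_graphD[OF eig] by blast
  have "\<exists>z\<in>\<int>. Q k t * Q k (2 * t) = z\<^sup>2"
  proof (cases "t = 0")
    case True
    then show ?thesis
      using asm kt by (intro bexI[of _ "char_set (chi n k) S2"]) (auto simp: Q_0 power2_eq_square)
  next
    case False
    then have t: "t = 1 \<or> t = 2" using kt(2) by linarith
    then have Qt: "Q k t * Q k (2 * t) = Q k 1 * Q k 2"
      by (auto simp: Q_4 mult.commute)
    have "\<exists>k'<n. Q k 1 * Q k 2 = Q k' 1 * Q k' 2"
    proof (cases "k < n")
      case True
      then show ?thesis by blast
    next
      case False
      then have "k - n < n" "k = (k - n) + n" using kt(1) by auto
      then show ?thesis
        using P_Q_shift(2)[of "k - n"] by (metis minus_mult_minus)
    qed
    then obtain m where m: "4 * (Q k 1 * Q k 2) = of_int (m\<^sup>2)"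
      using asm by (auto simp: char_set_sq_psi)
    \<comment> \<open>A quarter of a square is rational, so the ring makes the product an integer;
      then \<open>m\<close> is even and the product is the square of its half.\<close>
    then have q: "Q k 1 * Q k 2 = of_int (m\<^sup>2) / of_int 4" by (simp add: field_simps)
    have "Q k 1 * Q k 2 \<in> \<int>"
    proof (rule Ints_of_Rats_int_adjoin)
      show "Q k 1 * Q k 2 \<in> int_adjoin (cis (2 * pi / real (6 * n)))"
        by (intro int_adjoin.mult Q_int_adjoin)
      show "Q k 1 * Q k 2 \<in> \<rat>" unfolding q by (intro Rats_divide Rats_of_int)
    qed
    then obtain z where z: "Q k 1 * Q k 2 = of_int z" by (auto elim: Ints_cases)
    have "(of_int (4 * z) :: complex) = of_int (m\<^sup>2)" using m z by simp
    then have "4 * z = m\<^sup>2" by (simp only: of_int_eq_iff)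
    moreover have "even (4 * z)" by simp
    ultimately have "even (m\<^sup>2)" by simp
    then have "even m" by simp
    then obtain r where "m = 2 * r" by blast
    then have "Q k 1 * Q k 2 = (of_int r)\<^sup>2" using m by simp
    then show ?thesis unfolding Qt by (intro bexI[of _ "of_int r"]) auto
  qed
  then obtain z where z: "z \<in> \<int>" "(\<mu> - P k)\<^sup>2 = z\<^sup>2" using \<mu> by auto
  then have "\<mu> - P k = z \<or> \<mu> - P k = - z" by (simp add: power2_eq_iff)
  then have "\<mu> - P k \<in> \<int>" using z(1) by auto
  from Ints_add[OF this, of "P k"] show "\<mu> \<in> \<int>" using asm by simp
qed

end

section \<open>Translation from cosets to coordinates\<close>

theorem theorem4p1:
  fixes n :: nat and S1 S2 :: "(nat \<times> nat) set"
  defines "G \<equiv> U6n n"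
  defines "a \<equiv> gen_a n"
  defines "b \<equiv> gen_b n"
  defines "H \<equiv> generate G {a \<otimes>\<^bsub>G\<^esub> a}"
  assumes n: "n \<ge> 1"
    and S1: "S1 \<subseteq> H - {\<one>\<^bsub>G\<^esub>}"
    and S2: "S2 \<subseteq> (H #>\<^bsub>G\<^esub> a) \<union> (H #>\<^bsub>G\<^esub> (a \<otimes>\<^bsub>G\<^esub> b))
                    \<union> (H #>\<^bsub>G\<^esub> (a \<otimes>\<^bsub>G\<^esub> b \<otimes>\<^bsub>G\<^esub> b))"
    and one_notin: "\<one>\<^bsub>G\<^esub> \<notin> S1 \<union> S2"
    and symm: "(\<lambda>x. inv\<^bsub>G\<^esub> x) ` (S1 \<union> S2) = S1 \<union> S2"
  shows "integral_graph (carrier G) (cayley_adj G (S1 \<union> S2)) \<longleftrightarrow>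
           (S1 \<in> bool_alg (G\<lparr>carrier := H\<rparr>)
            \<and> (\<forall>j < 2*n. char_set (chi n j) S2 \<in> \<int>)
            \<and> (\<forall>k < n. \<exists>m::int. 2 * char_set_sq n (psi n k) S2 = of_int (m^2)))"
proof -
  have group: "group G" unfolding G_def by (rule group_U6n[OF n])
  \<comment> \<open>The reduction of 2 matters for \<open>n = 1\<close>, where the square of
    \<open>a\<close> is the identity.\<close>
  have aa: "a \<otimes>\<^bsub>G\<^esub> a = (2 mod (2 * n), 0)"
    using n by (simp add: a_def G_def gen_a_def U6n_mult mod_simps)
  have aa_carrier: "a \<otimes>\<^bsub>G\<^esub> a \<in> carrier G"
    unfolding aa using n by (simp add: G_def U6n_carrier)
  have subgroup: "subgroup H G"
    unfolding H_def using aa_carrier by (intro group.generate_is_subgroup[OF group]) simp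
  have H: "fst h < 2 * n \<and> even (fst h) \<and> snd h = 0" if "h \<in> H" for h
  proof -
    \<comment> \<open>The empty connection set gives access to the formula for powers of even
      elements.\<close>
    have "u6n_connection_set n {} {}" using n by unfold_locales auto
    note pow = u6n_connection_set.pow_even[OF this, of 2]
    obtain m :: nat where "h = (a \<otimes>\<^bsub>G\<^esub> a) [^]\<^bsub>G\<^esub> m"
      using \<open>h \<in> H\<close> group.generate_pow_on_finite_carrier[OF group _ aa_carrier]
      unfolding H_def by (auto simp: G_def finite_U6n)
    then have "h = (m * 2 mod (2 * n), 0)" unfolding aa using pow by (simp add: G_def)
    then show ?thesis using n by (simp add: even_mod_double)
  qed
  have S2': "fst s < 2 * n \<and> odd (fst s) \<and> snd s < 3" if "s \<in> S2" for s
  proof -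
    have ab: "a = (1, 0)" "a \<otimes>\<^bsub>G\<^esub> b = (1, 1)" "a \<otimes>\<^bsub>G\<^esub> b \<otimes>\<^bsub>G\<^esub> b = (1, 2)"
      using n by (simp_all add: a_def b_def gen_a_def gen_b_def G_def U6n_mult)
    obtain h c where "h \<in> H" "s = h \<otimes>\<^bsub>G\<^esub> (1, c)"
      using \<open>s \<in> S2\<close> S2 unfolding ab(3) unfolding ab(2) unfolding ab(1) r_coset_def by blast
    then show ?thesis
      using H[of h] n by (cases h) (simp add: G_def U6n_mult even_mod_double)
  qed
  have S: "u6n_connection_set n S1 S2"
  proof (rule u6n_connection_set.intro)
    show "fst s < 2 * n \<and> even (fst s) \<and> snd s = 0" if "s \<in> S1" for s
      using that S1 by (intro H) blast
    show "(\<lambda>x. inv\<^bsub>U6n n\<^esub> x) ` (S1 \<union> S2) = S1 \<union> S2"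
      using symm unfolding G_def .
  qed (fact n S2')+
  have "S1 \<subseteq> H" using S1 by blast
  with subgroup have "S1 \<in> bool_alg (G\<lparr>carrier := H\<rparr>) \<longleftrightarrow> (\<forall>k. char_set (chi n k) S1 \<in> \<int>)"
    unfolding G_def by (rule u6n_connection_set.bool_alg_iff_P_Ints[OF S])
  then show ?thesis
    using u6n_connection_set.integral_graph_iff_P_Q[OF S] unfolding G_def by simp
qed

end
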